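(* Two weight constraint programs are strongly equivalent if and only if they have the same SE-models.
   Context: Fix a set of propositional atoms; a literal is an atom $A$ or $\neg A$, and a set of literals is consistent if it does not contain both $A$ and $\neg A$. A rule element is a literal (positive rule element) or a literal preceded by $\mathit{not}$ (negative rule element). A weight assignment is $e=w$ with $e$ a rule element and $w$ a nonnegative real. A weight constraint is $L\le S\le U$ where $S$ is a finite set of weight assignments and $L,U$ are reals or $-\infty,+\infty$. A WCP rule is $C_0\leftarrow C_1,\dots,C_n$ ($n\ge0$) with weight constraints $C_i$ where $C_0$ contains no negative rule elements; the rule elements in $C_0$ are its head literals. A weight constraint program is a set of WCP rules. For a consistent set $X$ of literals, $X\models \ell$ iff $\ell\in X$ and $X\models\mathit{not}\,\ell$ iff $\ell\notin X$; $v(S,X)=\sum\{w : (e=w)\in S,\ X\models e\}$; $X$ satisfies $L\le S\le U$ iff $L\le v(S,X)\le U$; $X$ satisfies a rule if it satisfies $C_0$ whenever it satisfies all of $C_1,\dots,C_n$; $X$ satisfies a program if it satisfies every rule. The reduct of $L\le S$ w.r.t. $X$ is $L^X\le S'$ where $S'$ is the set of $e=w\in S$ with $e$ positive and $L^X=L-v(S\setminus S',X)$. The reduct w.r.t. $X$ of a rule $L_0\le S_0\le U_0\leftarrow L_1\le S_1\le U_1,\dots,L_n\le S_n\le U_n$ is the set of rules $e\leftarrow (L_1\le S_1)^X,\dots,(L_n\le S_n)^X$ for every head literal $e$ with $X\models e$, provided $v(S_i,X)\le U_i$ for all $i\in\{1,\dots,n\}$ (otherwise it is empty); here a literal $e$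 as head stands for the constraint $1\le\{e=1\}$. The reduct $P^X$ is the union of the reducts of the rules of $P$. $X$ is an answer set of $P$ if $X$ satisfies $P$ and no proper subset of $X$ satisfies $P^X$. Programs are equivalent if they have the same answer sets, and $P,Q$ are strongly equivalent if $P\cup R$ and $Q\cup R$ are equivalent for every weight constraint program $R$. For consistent sets of literals $X\subseteq Y$, $(X,Y)$ is an SE-model of $P$ if $Y$ satisfies $P$ and $X$ satisfies $P^Y$. *)

theory Defs
  imports "HOL-Library.Extended_Real"
begin

datatype 'a literal = Atom 'a | Neg 'a

definition consistent :: "'a literal set \<Rightarrow> bool" where
  "consistent X \<longleftrightarrow> (\<forall>a. \<not> (Atom a \<in> X \<and> Neg a \<in> X))"

datatype 'a rule_element = Lit "'a literal" | Not "'a literal"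

type_synonym 'a weight_assignment = "'a rule_element \<times> real"

text \<open>
  A weight constraint \<open>L \<le> S \<le> U\<close>.  An omitted upper bound is \<open>\<infinity>\<close>, so \<open>L \<le> S\<close> is
  \<open>WConstraint L S \<infinity>\<close>.  The side conditions (\<open>S\<close> finite, weights nonnegative, no
  negative rule elements in heads) are the predicates \<open>weight_constraint\<close>, \<open>wcp_rule\<close>
  and \<open>weight_constraint_program\<close> below.
\<close>
datatype 'a wconstraint =
  WConstraint (lower: ereal) (assignments: "'a weight_assignment set") (upper: ereal)

datatype 'a wrule = WRule (head: "'a wconstraint") (body: "'a wconstraint list")

definition weight_constraint :: "'a wconstraint \<Rightarrow> bool" where
  "weight_constraint C \<longleftrightarrow>
     finite (assignments C) \<and> (\<forall>(e, w) \<in> assignments C. 0 \<le> w)"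

definition wcp_rule :: "'a wrule \<Rightarrow> bool" where
  "wcp_rule r \<longleftrightarrow>
     weight_constraint (head r) \<and>
     (\<forall>C \<in> set (body r). weight_constraint C) \<and>
     (\<forall>l w. (Not l, w) \<notin> assignments (head r))"

definition weight_constraint_program :: "'a wrule set \<Rightarrow> bool" where
  "weight_constraint_program P \<longleftrightarrow> (\<forall>r \<in> P. wcp_rule r)"

definition head_literals :: "'a wrule \<Rightarrow> 'a literal set" where
  "head_literals r = {l. \<exists>w. (Lit l, w) \<in> assignments (head r)}"

fun holds :: "'a literal set \<Rightarrow> 'a rule_element \<Rightarrow> bool" where
  "holds X (Lit l) \<longleftrightarrow> l \<in> X"
| "holds X (Not l) \<longleftrightarrow> l \<notin> X"

text \<open>
  The sum ranges over weight assignments, not over weights, so equal weights of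
  different rule elements are all counted.
\<close>
definition val :: "'a weight_assignment set \<Rightarrow> 'a literal set \<Rightarrow> real" where
  "val S X = (\<Sum>(e, w) \<in> {(e, w) \<in> S. holds X e}. w)"

definition sat_constraint :: "'a literal set \<Rightarrow> 'a wconstraint \<Rightarrow> bool" where
  "sat_constraint X C \<longleftrightarrow>
     lower C \<le> ereal (val (assignments C) X) \<and> ereal (val (assignments C) X) \<le> upper C"

definition sat_rule :: "'a literal set \<Rightarrow> 'a wrule \<Rightarrow> bool" where
  "sat_rule X r \<longleftrightarrow>
     ((\<forall>C \<in> set (body r). sat_constraint X C) \<longrightarrow> sat_constraint X (head r))"

definition sat_program :: "'a literal set \<Rightarrow> 'a wrule set \<Rightarrow> bool" where
  "sat_program X P \<longleftrightarrow> (\<forall>r \<in> P. sat_rule X r)"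

definition positive_part :: "'a weight_assignment set \<Rightarrow> 'a weight_assignment set" where
  "positive_part S = {(e, w) \<in> S. \<exists>l. e = Lit l}"

text \<open>The reduct \<open>(L \<le> S)\<^sup>X\<close>; the upper bound of the given constraint is discarded.\<close>
definition reduct_constraint :: "'a literal set \<Rightarrow> 'a wconstraint \<Rightarrow> 'a wconstraint" where
  "reduct_constraint X C =
     (let S = assignments C; S' = positive_part S
      in WConstraint (lower C - ereal (val (S - S') X)) S' \<infinity>)"

definition literal_constraint :: "'a literal \<Rightarrow> 'a wconstraint" where
  "literal_constraint l = WConstraint 1 {(Lit l, 1)} \<infinity>"

definition reduct_rule :: "'a literal set \<Rightarrow> 'a wrule \<Rightarrow> 'a wrule set" where
  "reduct_rule X r =
     (if \<forall>C \<in> set (body r). ereal (val (assignments C) X) \<le> upper C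
      then {WRule (literal_constraint l) (map (reduct_constraint X) (body r)) | l.
              l \<in> head_literals r \<and> holds X (Lit l)}
      else {})"

definition reduct :: "'a wrule set \<Rightarrow> 'a literal set \<Rightarrow> 'a wrule set" where
  "reduct P X = (\<Union>r \<in> P. reduct_rule X r)"

definition answer_set :: "'a wrule set \<Rightarrow> 'a literal set \<Rightarrow> bool" where
  "answer_set P X \<longleftrightarrow>
     consistent X \<and> sat_program X P \<and> (\<forall>Z. Z \<subset> X \<longrightarrow> \<not> sat_program Z (reduct P X))"

definition equivalent :: "'a wrule set \<Rightarrow> 'a wrule set \<Rightarrow> bool" where
  "equivalent P Q \<longleftrightarrow> {X. answer_set P X} = {X. answer_set Q X}"

definition strongly_equivalent :: "'a wrule set \<Rightarrow> 'a wrule set \<Rightarrow> bool" where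
  "strongly_equivalent P Q \<longleftrightarrow>
     (\<forall>R. weight_constraint_program R \<longrightarrow> equivalent (P \<union> R) (Q \<union> R))"

definition SE_models :: "'a wrule set \<Rightarrow> ('a literal set \<times> 'a literal set) set" where
  "SE_models P =
     {(X, Y). consistent X \<and> consistent Y \<and> X \<subseteq> Y \<and>
              sat_program Y P \<and> sat_program X (reduct P Y)}"

end

theory Submission imports Defs begin

text \<open>
  The answer sets of \<open>P\<close> can be read off its SE-models: \<open>Y\<close> is an answer set iff \<open>(Y, Y)\<close> is an
  SE-model and no \<open>(X, Y)\<close> with \<open>X \<subset> Y\<close> is one.  As the SE-models of a union are the common
  SE-models, programs with the same SE-models are strongly equivalent.  Conversely, let \<open>(X, Y)\<close>
  be an SE-model of \<open>P\<close> only.  If \<open>Y\<close> does not satisfy \<open>Q\<close>, adding all elements of \<open>Y\<close> as facts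
  makes \<open>Y\<close> an answer set for \<open>P\<close> but not for \<open>Q\<close>.  Otherwise \<open>X \<subset> Y\<close>, and adding the elements
  of \<open>X\<close> as facts and all rules \<open>l \<leftarrow> k\<close> with \<open>l\<close>, \<open>k\<close> in \<open>Y - X\<close> leaves \<open>X\<close> and \<open>Y\<close> as the only
  candidate models of the reduct, so \<open>Y\<close> is an answer set for \<open>Q\<close> but not for \<open>P\<close>.
\<close>

lemma consistent_subset: "consistent Y \<Longrightarrow> X \<subseteq> Y \<Longrightarrow> consistent X"
  by (auto simp: consistent_def)

lemma sat_program_Un: "sat_program X (P \<union> Q) \<longleftrightarrow> sat_program X P \<and> sat_program X Q"
  by (auto simp: sat_program_def)

lemma reduct_Un: "reduct (P \<union> Q) X = reduct P X \<union> reduct Q X"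
  by (simp add: reduct_def)

lemma sat_literal_constraint: "sat_constraint X (literal_constraint l) \<longleftrightarrow> l \<in> X"
proof -
  have "{(e, w). (e, w) \<in> {(Lit l, 1::real)} \<and> holds X e} = (if l \<in> X then {(Lit l, 1)} else {})"
    by auto
  then show ?thesis
    by (simp add: sat_constraint_def literal_constraint_def val_def)
qed

text \<open>The reduct keeps only head literals that lie in \<open>X\<close>, so every head is
  already satisfied.\<close>

lemma sat_reduct_self: "sat_program X (reduct P X)"
  by (auto simp: sat_program_def reduct_def reduct_rule_def sat_rule_def sat_literal_constraint
      split: if_splits)

lemma SE_models_Un: "SE_models (P \<union> Q) = SE_models P \<inter> SE_models Q"
  by (auto simp: SE_models_def sat_program_Un reduct_Un)

lemma answer_set_iff_SE_models:
  "answer_set P Y \<longleftrightarrow> (Y, Y) \<in> SE_models P \<and> (\<forall>X. X \<subset> Y \<longrightarrow> (X, Y) \<notin> SE_models P)"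
  using consistent_subset[of Y]
  by (auto simp: answer_set_def SE_models_def sat_reduct_self)

lemma strongly_equivalent_if_SE_models_eq:
  "SE_models P = SE_models Q \<Longrightarrow> strongly_equivalent P Q"
  by (simp add: strongly_equivalent_def equivalent_def answer_set_iff_SE_models SE_models_Un)

definition literal_rule :: "'a literal \<Rightarrow> 'a literal list \<Rightarrow> 'a wrule" where
  "literal_rule l ks = WRule (literal_constraint l) (map literal_constraint ks)"

lemma wcp_literal_rule: "wcp_rule (literal_rule l ks)"
  by (auto simp: wcp_rule_def literal_rule_def literal_constraint_def weight_constraint_def)

lemma sat_literal_rule: "sat_rule X (literal_rule l ks) \<longleftrightarrow> (set ks \<subseteq> X \<longrightarrow> l \<in> X)"
  by (auto simp: sat_rule_def literal_rule_def sat_literal_constraint)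

text \<open>There is no negative rule element to remove, so the lower bound drops by an empty
  sum.\<close>

lemma reduct_literal_constraint: "reduct_constraint X (literal_constraint l) = literal_constraint l"
proof -
  have "positive_part {(Lit l, 1)} = {(Lit l, 1)}"
    by (auto simp: positive_part_def)
  moreover have "val {} X = 0"
    by (simp add: val_def)
  ultimately show ?thesis
    by (simp add: reduct_constraint_def literal_constraint_def)
qed

lemma reduct_literal_rule:
  "reduct_rule X (literal_rule l ks) = (if l \<in> X then {literal_rule l ks} else {})"
proof -
  have "head_literals (literal_rule l ks) = {l}"
    by (auto simp: head_literals_def literal_rule_def literal_constraint_def)
  moreover have "upper (literal_constraint k) = \<infinity>" for k :: "'a literal"
    by (simp add: literal_constraint_def)
  ultimately show ?thesis
    by (auto simp: reduct_rule_def literal_rule_def reduct_literal_constraint)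
qed

definition facts :: "'a literal set \<Rightarrow> 'a wrule set" where
  "facts X = (\<lambda>l. literal_rule l []) ` X"

definition clique :: "'a literal set \<Rightarrow> 'a wrule set" where
  "clique X = (\<lambda>(l, k). literal_rule l [k]) ` (X \<times> X)"

lemma wcp_facts: "weight_constraint_program (facts X)"
  by (auto simp: weight_constraint_program_def facts_def wcp_literal_rule)

lemma wcp_clique: "weight_constraint_program (clique X)"
  by (auto simp: weight_constraint_program_def clique_def wcp_literal_rule)

lemma sat_facts: "sat_program Z (facts X) \<longleftrightarrow> X \<subseteq> Z"
  by (auto simp: sat_program_def facts_def sat_literal_rule)

lemma sat_clique: "sat_program Z (clique X) \<longleftrightarrow> X \<inter> Z = {} \<or> X \<subseteq> Z"
  by (auto simp: sat_program_def clique_def sat_literal_rule)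

lemma reduct_idem: "(\<And>r. r \<in> P \<Longrightarrow> reduct_rule X r = {r}) \<Longrightarrow> reduct P X = P"
  by (simp add: reduct_def)

lemma reduct_facts: "X \<subseteq> Y \<Longrightarrow> reduct (facts X) Y = facts X"
  by (rule reduct_idem) (auto simp: facts_def reduct_literal_rule)

lemma reduct_clique: "X \<subseteq> Y \<Longrightarrow> reduct (clique X) Y = clique X"
  by (rule reduct_idem) (auto simp: clique_def reduct_literal_rule)

text \<open>The facts survive in the reduct and rule out every proper subset of \<open>Y\<close>, so
  minimality is automatic.\<close>

lemma answer_set_facts:
  assumes "consistent Y"
  shows "answer_set (P \<union> facts Y) Y \<longleftrightarrow> sat_program Y P"
  using assms by (auto simp: answer_set_def sat_program_Un reduct_Un reduct_facts sat_facts)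

lemma answer_set_facts_clique:
  assumes "consistent Y" "X \<subset> Y"
  shows "answer_set (P \<union> (facts X \<union> clique (Y - X))) Y \<longleftrightarrow>
    sat_program Y P \<and> \<not> sat_program X (reduct P Y)"
proof -
  let ?R = "facts X \<union> clique (Y - X)"
  have "X \<subseteq> Y" "Y - X \<subseteq> Y"
    using assms(2) by auto
  then have reduct_R: "reduct ?R Y = ?R"
    by (simp add: reduct_Un reduct_facts reduct_clique)
  have sat_R: "sat_program Z ?R \<longleftrightarrow> X \<subseteq> Z \<and> ((Y - X) \<inter> Z = {} \<or> Y - X \<subseteq> Z)" for Z
    by (simp add: sat_program_Un sat_facts sat_clique)
  \<comment> \<open>The facts put \<open>X\<close> inside \<open>Z\<close>; a proper subset of
    \<open>Y\<close> then cannot contain all of \<open>Y - X\<close>, so the clique rules make it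
    miss \<open>Y - X\<close> entirely.\<close>
  have "Z \<subset> Y \<and> sat_program Z ?R \<longleftrightarrow> Z = X" for Z
    unfolding sat_R using assms(2) by blast
  moreover have "sat_program Y ?R"
    unfolding sat_R using assms(2) by blast
  ultimately show ?thesis
    unfolding answer_set_def reduct_Un[of P] reduct_R sat_program_Un[of _ P]
      sat_program_Un[of _ "reduct P Y"]
    using assms(1) by metis
qed

text \<open>One inclusion suffices, as strong equivalence is symmetric.\<close>

lemma SE_models_subset_if_strongly_equivalent:
  assumes "strongly_equivalent P Q"
  shows "SE_models P \<subseteq> SE_models Q"
proof (rule subrelI)
  fix X Y
  assume "(X, Y) \<in> SE_models P"
  then have XY: "consistent X" "consistent Y" "X \<subseteq> Y" "sat_program Y P"
      "sat_program X (reduct P Y)"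
    by (auto simp: SE_models_def)
  have answer_set_eq: "answer_set (P \<union> R) Y \<longleftrightarrow> answer_set (Q \<union> R) Y"
    if "weight_constraint_program R" for R
    using assms that by (auto simp: strongly_equivalent_def equivalent_def)
  have "sat_program Y Q"
    using answer_set_eq[OF wcp_facts, of Y] XY by (simp add: answer_set_facts)
  moreover have "sat_program X (reduct Q Y)"
  proof (cases "X = Y")
    case True
    then show ?thesis by (simp add: sat_reduct_self)
  next
    case False
    have "weight_constraint_program (facts X \<union> clique (Y - X))"
      using wcp_facts wcp_clique by (auto simp: weight_constraint_program_def)
    \<comment> \<open>\<open>X\<close> refutes minimality of \<open>Y\<close> for the extended
      \<open>P\<close>, so \<open>Y\<close> is no answer set of the extended \<open>Q\<close>
      either; as \<open>Y\<close> satisfies \<open>Q\<close>, only \<open>X\<close> can be to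
      blame.\<close>
    from answer_set_eq[OF this] show ?thesis
      using XY False \<open>sat_program Y Q\<close> by (simp add: answer_set_facts_clique psubset_eq)
  qed
  ultimately show "(X, Y) \<in> SE_models Q"
    using XY by (simp add: SE_models_def)
qed

lemma strongly_equivalent_sym: "strongly_equivalent P Q \<Longrightarrow> strongly_equivalent Q P"
  by (simp add: strongly_equivalent_def equivalent_def)

theorem theorem5:
  fixes P Q :: "'a wrule set"
  assumes "weight_constraint_program P"
    and "weight_constraint_program Q"
  shows "strongly_equivalent P Q \<longleftrightarrow> SE_models P = SE_models Q"
proof
  assume "strongly_equivalent P Q"
  then show "SE_models P = SE_models Q"
    by (intro subset_antisym SE_models_subset_if_strongly_equivalent)
      (simp_all add: strongly_equivalent_sym)
next
  assume "SE_models P = SE_models Q"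
  then show "strongly_equivalent P Q"
    by (rule strongly_equivalent_if_SE_models_eq)
qed

end
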